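(* Let $t_x,t_y\ge 1$ be integers, $d=t_x+t_y$, and let $\Lambda=(x,\ldots,x,y,\ldots,y)$ be a $d$-tuple of essential weights in which $x$ appears $t_x$ times and $y$ appears $t_y$ times, where $1>x>y>0$, $x=\frac{p}{q}$, $y=\frac{s}{q}$ with $p,s,q$ positive integers and $q$ the least possible common denominator of $x$ and $y$. Then $\Lambda$ is an optimal hyperplane cover of an extremal matrix $A=A(\Lambda)$ of order $2$ if and only if $\gcd(p,s)=1$, $t_xp+t_ys=2q-1$, and there are integers $r_x,r_y,\ell_x,\ell_y$ satisfying all of the following conditions: \begin{itemize} \item $0\le r_x<\ell_x\le t_x$ and $0\le \ell_y<r_y\le t_y$; \item $\ell_x=r_x+is$ and $\ell_y=r_y-ip$ for some positive integer $i$; \item ($r_x<s$ or $r_y+p>t_y$) and ($\ell_x+s>t_x$ or $\ell_y<p$); \item $r_xp+r_ys=\ell_xp+\ell_ys=q$. \end{itemize} In particular, in this case the deficiency of the matrix $A$ is $\delta=\frac1q$.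
   Context: A $d$-dimensional $(0,1)$-matrix of order $2$ is an array $A=(a_\alpha)_{\alpha\in\{0,1\}^d}$ with $a_\alpha\in\{0,1\}$; its support is the set of $\alpha$ with $a_\alpha=1$. The hyperplanes are $\Gamma_{i,j}=\{\alpha:\alpha_i=j\}$, $1\le i\le d$, $j\in\{0,1\}$. A polydiagonal in $A$ is an assignment of nonnegative real weights to the entries of the support of $A$ such that the sum of the weights over each hyperplane equals $1$. $A$ is extremal if $A$ has no polydiagonal, and after adding any new index to the support of $A$ the resulting matrix has a polydiagonal. A polyplex of weight $W$ in $A$ is an assignment of nonnegative real weights to the entries of the support of $A$ such that the sum over each hyperplane is at most $1$ and the sum of all weights is $W$; it is optimal if $W$ is maximum possible. The deficiency of an extremal matrix $A$ of order $2$ is $\delta=2-W$, where $W$ is the weight of an optimal polyplex in $A$. A hyperplane cover of $A$ is a table $(\lambda_{i,j})$ of nonnegative real weights such that $\sum_{(i,j):\,\alpha\in\Gamma_{i,j}}\lambda_{i,j}\ge 1$ for every $\alpha$ in the support of $A$; its weight is the sum of all $\lambda_{i,j}$, and it is optimal if its weight is minimum among all hyperplane covers of $A$. A tuple $\Lambda=(\lambda_1,\ldots,\lambda_d)$ of essential weights denotes the table assigning, in each direction $i$, weight $\lambda_i$ to the hyperplane $\Gamma_{i,1}$ and weight $0$ to the parallel hyperplane $\Gamma_{i,0}$. The matrix $A(\Lambda)$ is given by $a_\alpha=1\iff\sum_{i:\,\alpha_i=1}\lambda_i\ge 1$. *)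

theory Defs
  imports "HOL-Library.FuncSet" Complex_Main
begin

definition indices :: "nat \<Rightarrow> (nat \<Rightarrow> nat) set" where
  "indices d = {1..d} \<rightarrow>\<^sub>E {0, 1}"

text \<open>A \<open>d\<close>-dimensional (0,1)-matrix of order 2; only the entries at indices in
  \<open>indices d\<close> are meaningful, and all notions below look only at those.\<close>

definition zero_one_matrix :: "nat \<Rightarrow> ((nat \<Rightarrow> nat) \<Rightarrow> nat) \<Rightarrow> bool" where
  "zero_one_matrix d A \<longleftrightarrow> (\<forall>\<alpha>\<in>indices d. A \<alpha> \<in> {0, 1})"

definition support :: "nat \<Rightarrow> ((nat \<Rightarrow> nat) \<Rightarrow> nat) \<Rightarrow> (nat \<Rightarrow> nat) set" where
  "support d A = {\<alpha> \<in> indices d. A \<alpha> = 1}"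

definition hyperplane :: "nat \<Rightarrow> nat \<Rightarrow> nat \<Rightarrow> (nat \<Rightarrow> nat) set" where
  "hyperplane d i j = {\<alpha> \<in> indices d. \<alpha> i = j}"

definition polydiagonal ::
  "nat \<Rightarrow> ((nat \<Rightarrow> nat) \<Rightarrow> nat) \<Rightarrow> ((nat \<Rightarrow> nat) \<Rightarrow> real) \<Rightarrow> bool" where
  "polydiagonal d A w \<longleftrightarrow>
     (\<forall>\<alpha>\<in>support d A. w \<alpha> \<ge> 0) \<and>
     (\<forall>i\<in>{1..d}. \<forall>j\<in>{0, 1}. (\<Sum>\<alpha>\<in>support d A \<inter> hyperplane d i j. w \<alpha>) = 1)"

definition extremal :: "nat \<Rightarrow> ((nat \<Rightarrow> nat) \<Rightarrow> nat) \<Rightarrow> bool" where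
  "extremal d A \<longleftrightarrow>
     zero_one_matrix d A \<and>
     (\<nexists>w. polydiagonal d A w) \<and>
     (\<forall>\<alpha>\<in>indices d - support d A. \<exists>w. polydiagonal d (A(\<alpha> := 1)) w)"

definition polyplex ::
  "nat \<Rightarrow> ((nat \<Rightarrow> nat) \<Rightarrow> nat) \<Rightarrow> real \<Rightarrow> ((nat \<Rightarrow> nat) \<Rightarrow> real) \<Rightarrow> bool" where
  "polyplex d A W w \<longleftrightarrow>
     (\<forall>\<alpha>\<in>support d A. w \<alpha> \<ge> 0) \<and>
     (\<forall>i\<in>{1..d}. \<forall>j\<in>{0, 1}. (\<Sum>\<alpha>\<in>support d A \<inter> hyperplane d i j. w \<alpha>) \<le> 1) \<and>
     (\<Sum>\<alpha>\<in>support d A. w \<alpha>) = W"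

definition optimal_polyplex ::
  "nat \<Rightarrow> ((nat \<Rightarrow> nat) \<Rightarrow> nat) \<Rightarrow> real \<Rightarrow> ((nat \<Rightarrow> nat) \<Rightarrow> real) \<Rightarrow> bool" where
  "optimal_polyplex d A W w \<longleftrightarrow>
     polyplex d A W w \<and> (\<forall>W' w'. polyplex d A W' w' \<longrightarrow> W' \<le> W)"

text \<open>The weight of an optimal polyplex is unique, so a relation is used here; unlike a
  definite description or supremum, it also asserts that an optimal polyplex exists.\<close>

definition has_deficiency :: "nat \<Rightarrow> ((nat \<Rightarrow> nat) \<Rightarrow> nat) \<Rightarrow> real \<Rightarrow> bool" where
  "has_deficiency d A \<delta> \<longleftrightarrow>
     extremal d A \<and> (\<exists>W w. optimal_polyplex d A W w \<and> \<delta> = 2 - W)"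

definition hyperplane_cover ::
  "nat \<Rightarrow> ((nat \<Rightarrow> nat) \<Rightarrow> nat) \<Rightarrow> (nat \<Rightarrow> nat \<Rightarrow> real) \<Rightarrow> bool" where
  "hyperplane_cover d A L \<longleftrightarrow>
     (\<forall>i\<in>{1..d}. \<forall>j\<in>{0, 1}. L i j \<ge> 0) \<and>
     (\<forall>\<alpha>\<in>support d A.
        (\<Sum>(i, j)\<in>{(i, j). i \<in> {1..d} \<and> j \<in> {0, 1} \<and> \<alpha> \<in> hyperplane d i j}. L i j) \<ge> 1)"

definition cover_weight :: "nat \<Rightarrow> (nat \<Rightarrow> nat \<Rightarrow> real) \<Rightarrow> real" where
  "cover_weight d L = (\<Sum>i\<in>{1..d}. \<Sum>j\<in>{0, 1}. L i j)"

definition optimal_hyperplane_cover ::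
  "nat \<Rightarrow> ((nat \<Rightarrow> nat) \<Rightarrow> nat) \<Rightarrow> (nat \<Rightarrow> nat \<Rightarrow> real) \<Rightarrow> bool" where
  "optimal_hyperplane_cover d A L \<longleftrightarrow>
     hyperplane_cover d A L \<and>
     (\<forall>L'. hyperplane_cover d A L' \<longrightarrow> cover_weight d L \<le> cover_weight d L')"

definition table_of :: "(nat \<Rightarrow> real) \<Rightarrow> nat \<Rightarrow> nat \<Rightarrow> real" where
  "table_of \<Lambda> i j = (if j = 1 then \<Lambda> i else 0)"

definition matrix_of :: "nat \<Rightarrow> (nat \<Rightarrow> real) \<Rightarrow> (nat \<Rightarrow> nat) \<Rightarrow> nat" where
  "matrix_of d \<Lambda> \<alpha> = (if (\<Sum>i\<in>{i \<in> {1..d}. \<alpha> i = 1}. \<Lambda> i) \<ge> 1 then 1 else 0)"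

definition two_valued_tuple :: "nat \<Rightarrow> real \<Rightarrow> real \<Rightarrow> nat \<Rightarrow> real" where
  "two_valued_tuple tx x y i = (if i \<le> tx then x else y)"

definition common_denominator :: "real \<Rightarrow> real \<Rightarrow> int \<Rightarrow> bool" where
  "common_denominator x y n \<longleftrightarrow>
     n > 0 \<and> (\<exists>a b :: int. x = of_int a / of_int n \<and> y = of_int b / of_int n)"

definition least_common_denominator :: "real \<Rightarrow> real \<Rightarrow> int \<Rightarrow> bool" where
  "least_common_denominator x y q \<longleftrightarrow>
     common_denominator x y q \<and> (\<forall>n. common_denominator x y n \<longrightarrow> q \<le> n)"

end

theory Submission
  imports Defs "HOL-Combinatorics.Transposition"
begin

text \<open>Averaging over the permutations of the coordinates within each block reduces everything to
  pairs \<open>(a, b)\<close> counting the ones of an index in the two blocks. Write \<open>W\<close> for the weight of \<open>\<Lambda>\<close>.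
  A polydiagonal of the matrix enlarged by \<open>\<alpha>\<close> gives \<open>\<alpha>\<close> weight at most 1, which forces the
  \<open>\<Lambda>\<close>-weight of \<open>\<alpha>\<close> to be at most \<open>W - 1\<close>, so the complement of \<open>\<alpha>\<close> is in the support; conversely
  an index and its complement carry a polydiagonal. Hence \<open>A\<close> is extremal iff \<open>W < 2\<close> and exactly one
  of each complementary pair is in the support. By duality, \<open>\<Lambda>\<close> is optimal iff the tight pairs, those
  with \<open>a p + b s = q\<close>, lie on both sides of the ray through \<open>(t\<^sub>x, t\<^sub>y)\<close>: otherwise the line of
  weight 1 can be tilted to a cheaper cover. The pairs \<open>(r\<^sub>x, r\<^sub>y)\<close> and \<open>(\<ell>\<^sub>x, \<ell>\<^sub>y)\<close> are the extreme
  tight pairs.\<close>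

section \<open>Covers, polyplexes and duality\<close>

definition index_weight :: "nat \<Rightarrow> (nat \<Rightarrow> nat \<Rightarrow> real) \<Rightarrow> (nat \<Rightarrow> nat) \<Rightarrow> real" where
  "index_weight d L \<alpha> = (\<Sum>i\<in>{1..d}. L i (\<alpha> i))"

lemma finite_indices [simp]: "finite (indices d)"
  unfolding indices_def by (simp add: finite_PiE)

lemma indices_cases: "\<alpha> \<in> indices d \<Longrightarrow> i \<in> {1..d} \<Longrightarrow> \<alpha> i = 0 \<or> \<alpha> i = 1"
  using PiE_mem[of \<alpha> "{1..d}" "\<lambda>_. {0, 1}" i] unfolding indices_def by simp

lemma finite_support [simp]: "finite (support d A)"
  unfolding support_def by simp

lemma support_subset: "support d A \<subseteq> indices d"
  unfolding support_def by auto

text \<open>An index lies in exactly one hyperplane of each direction, so the sum over pairs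
  collapses to a sum over directions.\<close>

lemma sum_hyperplanes_through:
  assumes "\<alpha> \<in> indices d"
  shows "(\<Sum>(i, j)\<in>{(i, j). i \<in> {1..d} \<and> j \<in> {0, 1} \<and> \<alpha> \<in> hyperplane d i j}. L i j)
    = index_weight d L \<alpha>"
proof -
  have "{(i, j). i \<in> {1..d} \<and> j \<in> {0, 1} \<and> \<alpha> \<in> hyperplane d i j} = (\<lambda>i. (i, \<alpha> i)) ` {1..d}"
    using indices_cases[OF assms] assms by (auto simp: hyperplane_def) (metis One_nat_def)
  moreover have "inj_on (\<lambda>i. (i, \<alpha> i)) {1..d}"
    by (auto simp: inj_on_def)
  ultimately show ?thesis
    unfolding index_weight_def by (simp add: sum.reindex)
qed

lemma hyperplane_cover_iff:
  "hyperplane_cover d A L \<longleftrightarrow>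
     (\<forall>i\<in>{1..d}. \<forall>j\<in>{0, 1}. L i j \<ge> 0) \<and> (\<forall>\<alpha>\<in>support d A. index_weight d L \<alpha> \<ge> 1)"
proof -
  have "(\<Sum>(i, j)\<in>{(i, j). i \<in> {1..d} \<and> j \<in> {0, 1} \<and> \<alpha> \<in> hyperplane d i j}. L i j)
      = index_weight d L \<alpha>" if "\<alpha> \<in> support d A" for \<alpha>
    using that support_subset by (intro sum_hyperplanes_through) blast
  then show ?thesis
    unfolding hyperplane_cover_def by (simp only: cong: ball_cong)
qed

lemma sum_split_hyperplanes:
  fixes w :: "(nat \<Rightarrow> nat) \<Rightarrow> real"
  assumes "T \<subseteq> indices d" "i \<in> {1..d}"
  shows "(\<Sum>\<alpha>\<in>T. w \<alpha> * g (\<alpha> i)) = (\<Sum>j\<in>{0, 1}. g j * (\<Sum>\<alpha>\<in>T \<inter> hyperplane d i j. w \<alpha>))"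
proof -
  have fin: "finite T"
    by (rule finite_subset[OF assms(1) finite_indices])
  have T: "T = (T \<inter> hyperplane d i 0) \<union> (T \<inter> hyperplane d i 1)"
    using assms indices_cases by (fastforce simp: hyperplane_def)
  have "(\<Sum>\<alpha>\<in>T. w \<alpha> * g (\<alpha> i)) =
      (\<Sum>\<alpha>\<in>T \<inter> hyperplane d i 0. w \<alpha> * g (\<alpha> i)) + (\<Sum>\<alpha>\<in>T \<inter> hyperplane d i 1. w \<alpha> * g (\<alpha> i))"
    by (subst T, rule sum.union_disjoint) (use fin in \<open>auto simp: hyperplane_def\<close>)
  also have "\<dots> = (\<Sum>\<alpha>\<in>T \<inter> hyperplane d i 0. g 0 * w \<alpha>) + (\<Sum>\<alpha>\<in>T \<inter> hyperplane d i 1. g 1 * w \<alpha>)"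
    by (intro arg_cong2[of _ _ _ _ "(+)"] sum.cong) (auto simp: hyperplane_def)
  finally show ?thesis
    by (simp add: sum_distrib_left)
qed

text \<open>The double counting behind every duality argument. \<open>T\<close> is arbitrary because
  it is applied both to a support and to a support with one index added.\<close>

lemma sum_weighted_index_weight:
  fixes w :: "(nat \<Rightarrow> nat) \<Rightarrow> real"
  assumes "T \<subseteq> indices d"
  shows "(\<Sum>\<alpha>\<in>T. w \<alpha> * index_weight d L \<alpha>)
    = (\<Sum>i\<in>{1..d}. \<Sum>j\<in>{0, 1}. L i j * (\<Sum>\<alpha>\<in>T \<inter> hyperplane d i j. w \<alpha>))"
proof -
  have "(\<Sum>\<alpha>\<in>T. w \<alpha> * index_weight d L \<alpha>) = (\<Sum>i\<in>{1..d}. \<Sum>\<alpha>\<in>T. w \<alpha> * L i (\<alpha> i))"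
    unfolding index_weight_def by (simp add: sum_distrib_left) (rule sum.swap)
  also have "\<dots> = (\<Sum>i\<in>{1..d}. \<Sum>j\<in>{0, 1}. L i j * (\<Sum>\<alpha>\<in>T \<inter> hyperplane d i j. w \<alpha>))"
    by (intro sum.cong refl sum_split_hyperplanes assms)
  finally show ?thesis .
qed

lemma sum_eq_hyperplanes:
  fixes w :: "(nat \<Rightarrow> nat) \<Rightarrow> real"
  assumes "T \<subseteq> indices d" "i \<in> {1..d}"
  shows "(\<Sum>\<alpha>\<in>T. w \<alpha>) = (\<Sum>\<alpha>\<in>T \<inter> hyperplane d i 0. w \<alpha>) + (\<Sum>\<alpha>\<in>T \<inter> hyperplane d i 1. w \<alpha>)"
  using sum_split_hyperplanes[OF assms, of w "\<lambda>_. 1"] by simp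

lemma sum_le_sum_mult:
  fixes f g :: "'a \<Rightarrow> real"
  assumes "\<And>a. a \<in> S \<Longrightarrow> f a \<ge> 0" "\<And>a. a \<in> S \<Longrightarrow> g a \<ge> 1"
  shows "(\<Sum>a\<in>S. f a) \<le> (\<Sum>a\<in>S. f a * g a)"
proof (rule sum_mono)
  fix a assume "a \<in> S"
  then have "f a * 1 \<le> f a * g a"
    using assms by (intro mult_left_mono)
  then show "f a \<le> f a * g a" by simp
qed

text \<open>Both weights are compared with the doubly counted sum: covering makes every factor on
  the support at least 1, and every hyperplane sum is at most 1.\<close>

lemma weak_duality:
  assumes "polyplex d A W w" "hyperplane_cover d A L"
  shows "W \<le> cover_weight d L"
proof -
  have w: "\<And>\<alpha>. \<alpha> \<in> support d A \<Longrightarrow> w \<alpha> \<ge> 0"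
      "\<And>i j. i \<in> {1..d} \<Longrightarrow> j \<in> {0, 1} \<Longrightarrow> (\<Sum>\<alpha>\<in>support d A \<inter> hyperplane d i j. w \<alpha>) \<le> 1"
      "W = (\<Sum>\<alpha>\<in>support d A. w \<alpha>)"
    using assms(1) by (auto simp: polyplex_def)
  have L: "\<And>i j. i \<in> {1..d} \<Longrightarrow> j \<in> {0, 1} \<Longrightarrow> L i j \<ge> 0"
      "\<And>\<alpha>. \<alpha> \<in> support d A \<Longrightarrow> index_weight d L \<alpha> \<ge> 1"
    using assms(2) by (auto simp: hyperplane_cover_iff)
  have "W \<le> (\<Sum>\<alpha>\<in>support d A. w \<alpha> * index_weight d L \<alpha>)"
    unfolding w(3) using w(1) L(2) by (rule sum_le_sum_mult)
  also have "\<dots> = (\<Sum>i\<in>{1..d}. \<Sum>j\<in>{0, 1}. L i j * (\<Sum>\<alpha>\<in>support d A \<inter> hyperplane d i j. w \<alpha>))"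
    by (rule sum_weighted_index_weight[OF support_subset])
  also have "\<dots> \<le> (\<Sum>i\<in>{1..d}. \<Sum>j\<in>{0, 1}. L i j)"
    using L(1) w(2) by (intro sum_mono mult_left_le) auto
  finally show ?thesis
    by (simp add: cover_weight_def)
qed

lemma polydiagonal_sum:
  assumes "polydiagonal d A w" "d \<ge> 1"
  shows "(\<Sum>\<alpha>\<in>support d A. w \<alpha>) = 2"
proof -
  have "(\<Sum>\<alpha>\<in>support d A \<inter> hyperplane d 1 j. w \<alpha>) = 1" if "j \<in> {0, 1}" for j
    using assms that unfolding polydiagonal_def by (meson atLeastAtMost_iff order_refl)
  then show ?thesis
    using sum_eq_hyperplanes[OF support_subset, of 1 d w A] assms(2) by simp
qed

lemma polydiagonal_imp_polyplex:
  assumes "polydiagonal d A w" "d \<ge> 1"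
  shows "polyplex d A 2 w"
  using assms(1) polydiagonal_sum[OF assms] by (simp add: polydiagonal_def polyplex_def)

text \<open>The two parallel hyperplanes of direction 1 contain all indices, whatever the matrix
  is.\<close>

lemma hyperplane_pair_cover:
  assumes "d \<ge> 1"
  shows "\<exists>L. hyperplane_cover d A L \<and> cover_weight d L = 2"
proof (intro exI conjI)
  let ?L = "\<lambda>i j::nat. if i = 1 then 1 else 0 :: real"
  have "(\<Sum>i\<in>{1..d}. if i = 1 then c else 0 :: real) = c" for c
    using assms by (simp add: sum.delta)
  then show "hyperplane_cover d A ?L"
    by (auto simp: hyperplane_cover_iff index_weight_def)
  have "cover_weight d ?L = (\<Sum>i\<in>{1..d}. if i = 1 then 2 else 0)"
    unfolding cover_weight_def by (intro sum.cong) auto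
  then show "cover_weight d ?L = 2"
    using assms by (simp add: sum.delta)
qed

lemma support_fun_upd:
  "\<alpha> \<in> indices d \<Longrightarrow> support d (A(\<alpha> := 1)) = insert \<alpha> (support d A)"
  by (auto simp: support_def)

text \<open>In a polydiagonal of the enlarged matrix the new index has weight at most 1, while every
  old index has cover weight at least 1.\<close>

lemma extremal_index_weight_le:
  assumes ext: "extremal d A" and cov: "hyperplane_cover d A L" and d: "d \<ge> 1"
    and \<alpha>: "\<alpha> \<in> indices d" "\<alpha> \<notin> support d A" and less: "index_weight d L \<alpha> < 1"
  shows "index_weight d L \<alpha> \<le> cover_weight d L - 1"
proof -
  obtain w where w: "polydiagonal d (A(\<alpha> := 1)) w"
    using ext \<alpha> unfolding extremal_def by blast
  let ?S = "support d A"
  have S': "support d (A(\<alpha> := 1)) = insert \<alpha> ?S"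
    by (rule support_fun_upd[OF \<alpha>(1)])
  have w0: "\<And>\<beta>. \<beta> \<in> insert \<alpha> ?S \<Longrightarrow> w \<beta> \<ge> 0"
    and w1: "\<And>i j. i \<in> {1..d} \<Longrightarrow> j \<in> {0, 1} \<Longrightarrow> (\<Sum>\<beta>\<in>insert \<alpha> ?S \<inter> hyperplane d i j. w \<beta>) = 1"
    using w unfolding polydiagonal_def S' by auto
  have "w \<alpha> \<le> (\<Sum>\<beta>\<in>insert \<alpha> ?S \<inter> hyperplane d 1 (\<alpha> 1). w \<beta>)"
    using w0 \<alpha>(1) by (intro member_le_sum) (auto simp: hyperplane_def)
  also have "\<dots> = 1"
    using indices_cases[OF \<alpha>(1), of 1] d by (intro w1) auto
  finally have le1: "w \<alpha> \<le> 1" .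
  have "(\<Sum>\<beta>\<in>insert \<alpha> ?S. w \<beta>) = 2"
    using polydiagonal_sum[OF w d] unfolding S' .
  then have two: "w \<alpha> + (\<Sum>\<beta>\<in>?S. w \<beta>) = 2"
    using \<alpha>(2) by simp
  have "(\<Sum>\<beta>\<in>insert \<alpha> ?S. w \<beta> * index_weight d L \<beta>) =
      (\<Sum>i\<in>{1..d}. \<Sum>j\<in>{0, 1}. L i j * (\<Sum>\<beta>\<in>insert \<alpha> ?S \<inter> hyperplane d i j. w \<beta>))"
    using \<alpha>(1) support_subset by (intro sum_weighted_index_weight) auto
  also have "\<dots> = cover_weight d L"
    unfolding cover_weight_def using w1 by (intro sum.cong refl) auto
  finally have W: "w \<alpha> * index_weight d L \<alpha> + (\<Sum>\<beta>\<in>?S. w \<beta> * index_weight d L \<beta>) = cover_weight d L"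
    using \<alpha>(2) by simp
  have "(\<Sum>\<beta>\<in>?S. w \<beta>) \<le> (\<Sum>\<beta>\<in>?S. w \<beta> * index_weight d L \<beta>)"
    using w0 cov by (intro sum_le_sum_mult) (auto simp: hyperplane_cover_iff)
  moreover have "w \<alpha> * (1 - index_weight d L \<alpha>) \<le> 1 * (1 - index_weight d L \<alpha>)"
    using le1 less by (intro mult_right_mono) auto
  ultimately show ?thesis
    using W two by (simp add: algebra_simps)
qed

section \<open>Complementary indices\<close>

definition complement_index :: "nat \<Rightarrow> (nat \<Rightarrow> nat) \<Rightarrow> nat \<Rightarrow> nat" where
  "complement_index d \<alpha> = (\<lambda>i\<in>{1..d}. 1 - \<alpha> i)"

lemma complement_index_in_indices: "complement_index d \<alpha> \<in> indices d"
  by (auto simp: complement_index_def indices_def)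

text \<open>Each hyperplane contains exactly one of an index and its complement, so weight 1 on both
  suffices.\<close>

lemma polydiagonal_antipodal:
  assumes \<alpha>: "\<alpha> \<in> indices d" and c: "complement_index d \<alpha> \<in> support d A" and d: "d \<ge> 1"
  shows "\<exists>w. polydiagonal d (A(\<alpha> := 1)) w"
proof -
  let ?c = "complement_index d \<alpha>"
  let ?w = "\<lambda>\<beta>. if \<beta> \<in> {\<alpha>, ?c} then 1 else 0 :: real"
  have "polydiagonal d (A(\<alpha> := 1)) ?w"
    unfolding polydiagonal_def support_fun_upd[OF \<alpha>]
  proof (intro conjI ballI)
    fix i j :: nat assume i: "i \<in> {1..d}" and j: "j \<in> {0, 1}"
    let ?T = "insert \<alpha> (support d A) \<inter> hyperplane d i j"
    have ci: "?c i = 1 - \<alpha> i"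
      using i by (simp add: complement_index_def)
    have "?T \<inter> {\<alpha>, ?c} = (if \<alpha> i = j then {\<alpha>} else {?c})"
      using indices_cases[OF \<alpha> i] ci j c \<alpha> support_subset[of d A] by (auto simp: hyperplane_def)
    then have "card (?T \<inter> {\<alpha>, ?c}) = 1"
      by simp
    moreover have "(\<Sum>\<beta>\<in>?T. ?w \<beta>) = (\<Sum>\<beta>\<in>?T \<inter> {\<alpha>, ?c}. 1)"
      by (rule sum.inter_restrict[symmetric]) simp
    ultimately show "(\<Sum>\<beta>\<in>?T. ?w \<beta>) = 1"
      by simp
  qed auto
  then show ?thesis by blast
qed

section \<open>Matrices with two essential weights\<close>

definition ones :: "nat set \<Rightarrow> (nat \<Rightarrow> nat) \<Rightarrow> nat" where
  "ones I \<alpha> = card {i \<in> I. \<alpha> i = 1}"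

lemma ones_le: "finite I \<Longrightarrow> ones I \<alpha> \<le> card I"
  unfolding ones_def by (intro card_mono) auto

text \<open>Counts the pairs of an index in \<open>T\<close> and a coordinate in \<open>I\<close>
  where it is 1, in both orders.\<close>

lemma sum_card_hyperplane:
  assumes fin: "finite T" "finite I" and T: "T \<subseteq> indices d" and ones: "\<And>\<alpha>. \<alpha> \<in> T \<Longrightarrow> ones I \<alpha> = a"
  shows "(\<Sum>i\<in>I. card (T \<inter> hyperplane d i 1)) = a * card T"
proof -
  have "(\<Sum>i\<in>I. card (T \<inter> hyperplane d i 1)) = (\<Sum>i\<in>I. \<Sum>\<alpha>\<in>T. if \<alpha> i = 1 then 1 else 0)"
  proof (rule sum.cong)
    fix i
    have "T \<inter> hyperplane d i 1 = T \<inter> {\<alpha>. \<alpha> i = 1}"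
      using T by (auto simp: hyperplane_def)
    then show "card (T \<inter> hyperplane d i 1) = (\<Sum>\<alpha>\<in>T. if \<alpha> i = 1 then 1 else 0)"
      using fin by (simp add: sum.If_cases)
  qed simp
  also have "\<dots> = (\<Sum>\<alpha>\<in>T. \<Sum>i\<in>I. if \<alpha> i = 1 then 1 else 0)"
    by (rule sum.swap)
  also have "\<dots> = (\<Sum>\<alpha>\<in>T. a)"
    using fin ones by (intro sum.cong refl) (auto simp: sum.If_cases ones_def Int_def)
  finally show ?thesis
    by simp
qed

text \<open>Transpositions are bijections between the slices of \<open>T\<close>, so all
  \<open>card I\<close> slices have the same size and the double count determines it.\<close>

lemma card_hyperplane_of_symmetric:
  assumes fin: "finite I" and T: "T \<subseteq> indices d" and ones: "\<And>\<alpha>. \<alpha> \<in> T \<Longrightarrow> ones I \<alpha> = a"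
    and sym: "\<And>\<alpha> i j. \<alpha> \<in> T \<Longrightarrow> i \<in> I \<Longrightarrow> j \<in> I \<Longrightarrow> \<alpha> \<circ> transpose i j \<in> T"
    and i: "i \<in> I"
  shows "card I * card (T \<inter> hyperplane d i 1) = a * card T"
proof -
  have finT: "finite T"
    by (rule finite_subset[OF T finite_indices])
  have eq: "card (T \<inter> hyperplane d j 1) = card (T \<inter> hyperplane d i 1)" if j: "j \<in> I" for j
  proof (rule bij_betw_same_card)
    have "(\<alpha> \<circ> transpose i j) \<circ> transpose i j = \<alpha>" for \<alpha> :: "nat \<Rightarrow> nat"
      by (simp add: comp_assoc)
    then show "bij_betw (\<lambda>\<alpha>. \<alpha> \<circ> transpose i j) (T \<inter> hyperplane d j 1) (T \<inter> hyperplane d i 1)"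
      using sym[OF _ i j] T
      by (intro bij_betwI[where g = "\<lambda>\<alpha>. \<alpha> \<circ> transpose i j"]) (auto simp: hyperplane_def)
  qed
  have "a * card T = (\<Sum>j\<in>I. card (T \<inter> hyperplane d j 1))"
    using sum_card_hyperplane[OF finT fin T ones] by simp
  also have "\<dots> = (\<Sum>j\<in>I. card (T \<inter> hyperplane d i 1))"
    using eq by (intro sum.cong) auto
  finally show ?thesis
    by simp
qed

definition block_class :: "nat \<Rightarrow> nat \<Rightarrow> nat \<Rightarrow> nat \<Rightarrow> (nat \<Rightarrow> nat) set" where
  "block_class m n a b = {\<alpha> \<in> indices (m + n). ones {1..m} \<alpha> = a \<and> ones {m+1..m+n} \<alpha> = b}"

lemma block_class_subset: "block_class m n a b \<subseteq> indices (m + n)"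
  by (auto simp: block_class_def)

lemma finite_block_class [simp]: "finite (block_class m n a b)"
  by (rule finite_subset[OF block_class_subset finite_indices])

lemma block_class_nonempty:
  assumes "a \<le> m" "b \<le> n"
  shows "block_class m n a b \<noteq> {}"
proof -
  let ?\<alpha> = "\<lambda>i\<in>{1..m+n}. if i \<in> {1..a} \<union> {m+1..m+b} then 1 else 0 :: nat"
  have "{i \<in> {1..m}. ?\<alpha> i = 1} = {1..a}" "{i \<in> {m+1..m+n}. ?\<alpha> i = 1} = {m+1..m+b}"
    using assms by (auto split: if_splits)
  moreover have "?\<alpha> \<in> indices (m + n)"
    by (auto simp: indices_def)
  ultimately have "?\<alpha> \<in> block_class m n a b"
    unfolding block_class_def ones_def by simp
  then show ?thesis by blast
qed

text \<open>The equivalence covers both uses: two coordinates of the block itself, or two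
  coordinates outside it.\<close>

lemma ones_transpose:
  assumes "i \<in> I \<longleftrightarrow> j \<in> I"
  shows "ones I (\<alpha> \<circ> transpose i j) = ones I \<alpha>"
proof -
  have "transpose i j k \<in> I \<longleftrightarrow> k \<in> I" for k
    using assms by (simp add: transpose_def)
  then have "bij_betw (transpose i j) {k \<in> I. (\<alpha> \<circ> transpose i j) k = 1} {k \<in> I. \<alpha> k = 1}"
    by (intro bij_betwI[where g = "transpose i j"]) simp_all
  then show ?thesis
    unfolding ones_def by (rule bij_betw_same_card)
qed

lemma indices_transpose:
  assumes "\<alpha> \<in> indices d" "i \<in> {1..d}" "j \<in> {1..d}"
  shows "\<alpha> \<circ> transpose i j \<in> indices d"
proof -
  have "transpose i j k \<in> {1..d} \<longleftrightarrow> k \<in> {1..d}" for k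
    using assms(2,3) by (simp add: transpose_def)
  then show ?thesis
    using assms(1) unfolding indices_def PiE_iff extensional_def mem_Collect_eq o_apply by blast
qed

lemma block_class_transpose:
  assumes "\<alpha> \<in> block_class m n a b" "i \<in> I" "j \<in> I" "I = {1..m} \<or> I = {m+1..m+n}"
  shows "\<alpha> \<circ> transpose i j \<in> block_class m n a b"
proof -
  have "i \<in> {1..m} \<longleftrightarrow> j \<in> {1..m}" "i \<in> {m+1..m+n} \<longleftrightarrow> j \<in> {m+1..m+n}"
    "i \<in> {1..m+n}" "j \<in> {1..m+n}"
    using assms(2-4) by auto
  then show ?thesis
    using assms(1) ones_transpose[of i _ j \<alpha>] indices_transpose[of \<alpha> "m + n" i j]
    unfolding block_class_def by (simp only: mem_Collect_eq)
qed

text \<open>The probability that coordinate \<open>i\<close> of a uniformly chosen member of the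
  class is 1.\<close>

lemma card_block_class_hyperplane:
  assumes i: "i \<in> {1..m+n}" and ab: "a \<le> m" "b \<le> n"
  shows "real (card (block_class m n a b \<inter> hyperplane (m + n) i 1)) / card (block_class m n a b) =
    (if i \<le> m then real a / m else real b / n)"
proof -
  let ?T = "block_class m n a b"
  have ne: "?T \<noteq> {}"
    by (rule block_class_nonempty[OF ab])
  have *: "card I * card (?T \<inter> hyperplane (m + n) i 1) = c * card ?T"
    if "I = {1..m} \<and> c = a \<or> I = {m+1..m+n} \<and> c = b" "i \<in> I" for I c
    using that
    by (intro card_hyperplane_of_symmetric block_class_subset block_class_transpose)
      (auto simp: block_class_def)
  show ?thesis
  proof (cases "i \<le> m")
    case True
    then have "m * card (?T \<inter> hyperplane (m + n) i 1) = a * card ?T"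
      using *[of "{1..m}" a] i by auto
    then have "real m * card (?T \<inter> hyperplane (m + n) i 1) = real a * card ?T"
      by (metis of_nat_mult)
    moreover have "m > 0" using True i by auto
    ultimately show ?thesis
      using ne True by (simp add: field_simps)
  next
    case False
    then have "n * card (?T \<inter> hyperplane (m + n) i 1) = b * card ?T"
      using *[of "{m+1..m+n}" b] i by auto
    then have "real n * card (?T \<inter> hyperplane (m + n) i 1) = real b * card ?T"
      by (metis of_nat_mult)
    moreover have "n > 0" using False i by auto
    ultimately show ?thesis
      using ne False by (simp add: field_simps)
  qed
qed

section \<open>Averaged weights on two block classes\<close>

definition uniform_weight :: "'a set \<Rightarrow> 'a \<Rightarrow> real" where
  "uniform_weight T \<alpha> = (if \<alpha> \<in> T then 1 / card T else 0)"

lemma sum_uniform_weight: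
  assumes "finite S" "T \<subseteq> S"
  shows "(\<Sum>\<alpha>\<in>S \<inter> H. uniform_weight T \<alpha>) = card (T \<inter> H) / card T"
proof -
  have "(\<Sum>\<alpha>\<in>S \<inter> H. uniform_weight T \<alpha>) = (\<Sum>\<alpha>\<in>S \<inter> H \<inter> T. 1 / card T)"
    unfolding uniform_weight_def using assms by (intro sum.inter_restrict[symmetric]) auto
  also have "S \<inter> H \<inter> T = T \<inter> H"
    using assms by auto
  finally show ?thesis
    by simp
qed

text \<open>Masses \<mu> and \<nu> are spread uniformly over the two classes. A hyperplane with
  \<open>j = 1\<close> then receives (\<mu> a + \<nu> a') / m or (\<mu> b + \<nu> b') / n, both
  equal to 1; its parallel receives the rest of the mass.\<close>

lemma balanced_weights:
  fixes \<mu> \<nu> :: real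
  assumes box: "a \<le> m" "b \<le> n" "a' \<le> m" "b' \<le> n"
    and sub: "block_class m n a b \<subseteq> support (m + n) A" "block_class m n a' b' \<subseteq> support (m + n) A"
    and \<mu>\<nu>: "\<mu> \<ge> 0" "\<nu> \<ge> 0" "\<mu> * a + \<nu> * a' = m" "\<mu> * b + \<nu> * b' = n" and m: "m \<ge> 1"
  obtains w where "\<And>\<alpha>. w \<alpha> \<ge> 0" "(\<Sum>\<alpha>\<in>support (m + n) A. w \<alpha>) = \<mu> + \<nu>"
    "\<And>i. i \<in> {1..m+n} \<Longrightarrow> (\<Sum>\<alpha>\<in>support (m + n) A \<inter> hyperplane (m + n) i 1. w \<alpha>) = 1"
    "\<And>i. i \<in> {1..m+n} \<Longrightarrow> (\<Sum>\<alpha>\<in>support (m + n) A \<inter> hyperplane (m + n) i 0. w \<alpha>) = \<mu> + \<nu> - 1"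
proof -
  let ?T = "block_class m n a b" and ?T' = "block_class m n a' b'" and ?S = "support (m + n) A"
  define w where "w = (\<lambda>\<alpha>. \<mu> * uniform_weight ?T \<alpha> + \<nu> * uniform_weight ?T' \<alpha>)"
  have sum: "(\<Sum>\<alpha>\<in>?S \<inter> H. w \<alpha>) = \<mu> * (card (?T \<inter> H) / card ?T) + \<nu> * (card (?T' \<inter> H) / card ?T')" for H
    unfolding w_def using sub
    by (simp add: sum.distrib sum_distrib_left[symmetric] sum_uniform_weight)
  have "?T \<noteq> {}" "?T' \<noteq> {}"
    using block_class_nonempty box by blast+
  then have total: "(\<Sum>\<alpha>\<in>?S. w \<alpha>) = \<mu> + \<nu>"
    using sum[of UNIV] by simp
  have one: "(\<Sum>\<alpha>\<in>?S \<inter> hyperplane (m + n) i 1. w \<alpha>) = 1" if i: "i \<in> {1..m+n}" for i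
  proof -
    have "n > 0" if "\<not> i \<le> m"
      using that i by auto
    then show ?thesis
      unfolding sum card_block_class_hyperplane[OF i box(1,2)] card_block_class_hyperplane[OF i box(3,4)]
      using \<mu>\<nu>(3,4) m by (auto simp: add_divide_distrib[symmetric])
  qed
  show ?thesis
  proof
    show "w \<alpha> \<ge> 0" for \<alpha>
      unfolding w_def uniform_weight_def using \<mu>\<nu> by auto
    show "(\<Sum>\<alpha>\<in>?S \<inter> hyperplane (m + n) i 0. w \<alpha>) = \<mu> + \<nu> - 1" if i: "i \<in> {1..m+n}" for i
      using sum_eq_hyperplanes[OF support_subset i, of w A] one[OF i] total by simp
  qed (use total one in auto)
qed

section \<open>Index weights and cover weights of two-valued tables\<close>

lemma table_of_sum: "(\<Sum>j\<in>{0, 1}. table_of \<Lambda> i j) = \<Lambda> i"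
  by (simp add: table_of_def)

lemma index_weight_table_of:
  "index_weight d (table_of \<Lambda>) \<alpha> = (\<Sum>i\<in>{i \<in> {1..d}. \<alpha> i = 1}. \<Lambda> i)"
  unfolding index_weight_def table_of_def by (rule sum.inter_filter[symmetric]) simp

lemma support_matrix_of:
  "support d (matrix_of d \<Lambda>) = {\<alpha> \<in> indices d. index_weight d (table_of \<Lambda>) \<alpha> \<ge> 1}"
  unfolding support_def matrix_of_def index_weight_table_of by auto

lemma blocks_union: "{1..m+n} = {1..m} \<union> {m+1..m+n::nat}"
  by auto

lemma index_weight_two_valued:
  fixes x y :: real
  shows
  "index_weight (m + n) (table_of (two_valued_tuple m x y)) \<alpha> =
    ones {1..m} \<alpha> * x + ones {m+1..m+n} \<alpha> * y"
proof -
  have eq: "{i \<in> {1..m+n}. \<alpha> i = 1} = {i \<in> {1..m}. \<alpha> i = 1} \<union> {i \<in> {m+1..m+n}. \<alpha> i = 1}"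
    by auto
  have disj: "{i \<in> {1..m}. \<alpha> i = 1} \<inter> {i \<in> {m+1..m+n}. \<alpha> i = 1} = {}"
    by auto
  have "index_weight (m + n) (table_of (two_valued_tuple m x y)) \<alpha> =
      (\<Sum>i\<in>{i \<in> {1..m}. \<alpha> i = 1}. two_valued_tuple m x y i) +
      (\<Sum>i\<in>{i \<in> {m+1..m+n}. \<alpha> i = 1}. two_valued_tuple m x y i)"
    unfolding index_weight_table_of eq by (rule sum.union_disjoint[OF _ _ disj]) simp_all
  also have "\<dots> = (\<Sum>i\<in>{i \<in> {1..m}. \<alpha> i = 1}. x) + (\<Sum>i\<in>{i \<in> {m+1..m+n}. \<alpha> i = 1}. y)"
    by (intro arg_cong2[of _ _ _ _ "(+)"] sum.cong) (auto simp: two_valued_tuple_def)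
  finally show ?thesis
    by (simp add: ones_def)
qed

lemma cover_weight_two_valued:
  fixes x y :: real
  shows
  "cover_weight (m + n) (table_of (two_valued_tuple m x y)) = m * x + n * y"
proof -
  have "cover_weight (m + n) (table_of (two_valued_tuple m x y)) =
      (\<Sum>i\<in>{1..m}. two_valued_tuple m x y i) + (\<Sum>i\<in>{m+1..m+n}. two_valued_tuple m x y i)"
    unfolding cover_weight_def table_of_sum blocks_union by (rule sum.union_disjoint) auto
  also have "\<dots> = (\<Sum>i\<in>{1..m}. x) + (\<Sum>i\<in>{m+1..m+n}. y)"
    by (intro arg_cong2[of _ _ _ _ "(+)"] sum.cong) (auto simp: two_valued_tuple_def)
  finally show ?thesis
    by simp
qed

lemma ones_complement_index:
  assumes "\<alpha> \<in> indices d" "finite I" "I \<subseteq> {1..d}"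
  shows "ones I (complement_index d \<alpha>) = card I - ones I \<alpha>"
proof -
  have "{i \<in> I. complement_index d \<alpha> i = 1} = I - {i \<in> I. \<alpha> i = 1}"
    using assms indices_cases[OF assms(1)] by (fastforce simp: complement_index_def)
  then show ?thesis
    unfolding ones_def using assms(2) by (simp add: card_Diff_subset)
qed

section \<open>Pairs of counts with integer values \<open>a p + b s\<close>\<close>

locale two_weights =
  fixes m n :: nat and p s q :: int and x y :: real and A :: "(nat \<Rightarrow> nat) \<Rightarrow> nat"
    and L :: "nat \<Rightarrow> nat \<Rightarrow> real"
  assumes m: "m \<ge> 1" and n: "n \<ge> 1" and p: "p > 0" and s: "s > 0" and q: "q > 0"
    and x: "x = of_int p / of_int q" and y: "y = of_int s / of_int q"
    and A: "A = matrix_of (m + n) (two_valued_tuple m x y)"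
    and L: "L = table_of (two_valued_tuple m x y)"
begin

abbreviation total :: int where
  "total \<equiv> int m * p + int n * s"

text \<open>By complementary slackness, only indices of weight exactly 1 can carry weight in a
  polyplex as heavy as the cover \<open>L\<close>.\<close>

definition tight :: "nat \<Rightarrow> nat \<Rightarrow> bool" where
  "tight a b \<longleftrightarrow> a \<le> m \<and> b \<le> n \<and> int a * p + int b * s = q"

text \<open>Clearing the denominator \<open>q\<close> turns comparisons of real weights with 1 into
  comparisons of integers with \<open>q\<close>.\<close>

lemma weight_eq: "real a * x + real b * y = of_int (int a * p + int b * s) / of_int q"
  by (simp add: x y add_divide_distrib)

lemma weight_ge_iff: "real a * x + real b * y \<ge> 1 \<longleftrightarrow> int a * p + int b * s \<ge> q"
  unfolding weight_eq using q by (simp add: le_divide_eq del: of_int_add of_int_mult)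

lemma index_weight_eq: "index_weight (m + n) L \<alpha> = ones {1..m} \<alpha> * x + ones {m+1..m+n} \<alpha> * y"
  unfolding L by (rule index_weight_two_valued)

lemma cover_weight_eq: "cover_weight (m + n) L = of_int total / of_int q"
  unfolding L cover_weight_two_valued weight_eq ..

lemma mem_support_iff:
  "\<alpha> \<in> support (m + n) A \<longleftrightarrow>
    \<alpha> \<in> indices (m + n) \<and> int (ones {1..m} \<alpha>) * p + int (ones {m+1..m+n} \<alpha>) * s \<ge> q"
  unfolding A support_matrix_of L[symmetric] index_weight_eq weight_ge_iff by simp

lemma ones_block_le: "ones {1..m} \<alpha> \<le> m" "ones {m+1..m+n} \<alpha> \<le> n"
  using ones_le[of "{1..m}" \<alpha>] ones_le[of "{m+1..m+n}" \<alpha>] by auto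

lemma block_class_subset_support:
  "int a * p + int b * s \<ge> q \<Longrightarrow> block_class m n a b \<subseteq> support (m + n) A"
  by (auto simp: block_class_def mem_support_iff)

lemma zero_one_matrix_A: "zero_one_matrix (m + n) A"
  by (auto simp: A zero_one_matrix_def matrix_of_def)

lemma x_pos: "x > 0" and y_pos: "y > 0"
  using p s q by (simp_all add: x y)

lemma cover: "hyperplane_cover (m + n) A L"
  unfolding hyperplane_cover_iff A support_matrix_of L
  using x_pos y_pos by (simp add: table_of_def two_valued_tuple_def)

section \<open>Optimality of the cover and tight pairs on both sides of the ray\<close>

text \<open>The pairs \<open>(a, b)\<close> and \<open>(a', b')\<close> lie on the two closed sides of the ray through \<open>(m, n)\<close>,
  so \<open>(m, n)\<close> is in the cone they span.\<close>

lemma cone_combination: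
  assumes "tight a b" "tight a' b'" "a * n \<le> b * m" "b' * m \<le> a' * n"
  obtains \<mu> \<nu> :: real where "\<mu> \<ge> 0" "\<nu> \<ge> 0" "\<mu> * a + \<nu> * a' = m" "\<mu> * b + \<nu> * b' = n"
proof -
  \<comment> \<open>A tight pair on the ray itself is handled alone, since the determinant below may
    then vanish.\<close>
  have ray: "\<exists>\<mu>::real. \<mu> \<ge> 0 \<and> \<mu> * c = m \<and> \<mu> * e = n" if "tight c e" "c * n = e * m" for c e
  proof -
    have "c \<noteq> 0 \<or> e \<noteq> 0"
      using that(1) q by (cases "c = 0"; cases "e = 0") (auto simp: tight_def)
    then have "c > 0"
      using that(2) m n by (cases "c = 0") auto
    moreover have "real c * n = real e * m"
      using that(2) by (metis of_nat_mult)
    ultimately show ?thesis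
      by (intro exI[of _ "m / c"]) (simp add: field_simps)
  qed
  consider "a * n = b * m" | "b' * m = a' * n" | "a * n < b * m" "b' * m < a' * n"
    using assms(3,4) by linarith
  then show thesis
  proof cases
    case 1
    then show thesis
      using ray[OF assms(1)] that[of _ 0] by fastforce
  next
    case 2
    then show thesis
      using ray[OF assms(2)] that[of 0] by fastforce
  next
    case 3
    \<comment> \<open>Multiplying the two strict slope inequalities and cancelling
      \<open>m n\<close> makes the determinant \<open>a' b - a b'\<close> positive; \<mu> and \<nu>
      are then given by Cramer's rule.\<close>
    have "(a * n) * (b' * m) < (b * m) * (a' * n)"
      by (rule mult_strict_mono[OF 3 le_less_trans[OF le0 3(1)] le0])
    then have "(a * b') * (m * n) < (a' * b) * (m * n)"
      by (simp only: ac_simps)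
    then have "a * b' < a' * b"
      by simp
    then have D: "real a' * b - real a * b' > 0"
      by (metis diff_gt_0_iff_gt of_nat_less_iff of_nat_mult)
    define \<mu> where "\<mu> = (real a' * n - real b' * m) / (real a' * b - real a * b')"
    define \<nu> where "\<nu> = (real b * m - real a * n) / (real a' * b - real a * b')"
    have "real b' * m \<le> real a' * n" "real a * n \<le> real b * m"
      using assms(3,4) by (metis of_nat_le_iff of_nat_mult)+
    then have "\<mu> \<ge> 0" "\<nu> \<ge> 0"
      unfolding \<mu>_def \<nu>_def using D by auto
    moreover have "\<mu> * a + \<nu> * a' = m" "\<mu> * b + \<nu> * b' = n"
      unfolding \<mu>_def \<nu>_def using D by (simp_all add: divide_simps) algebra+
    ultimately show thesis
      by (rule that)
  qed
qed

text \<open>Both tight pairs have weight 1, so weighing (m, n) = \<mu> (a, b) + \<nu> (a', b') by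
  (x, y) shows that the total mass \<mu> + \<nu> is \<open>total / q\<close>.\<close>

lemma balanced_weights_exist:
  assumes "tight a b" "tight a' b'" "a * n \<le> b * m" "b' * m \<le> a' * n"
  obtains w :: "(nat \<Rightarrow> nat) \<Rightarrow> real"
  where "\<And>\<alpha>. w \<alpha> \<ge> 0" "(\<Sum>\<alpha>\<in>support (m + n) A. w \<alpha>) = of_int total / of_int q"
    "\<And>i. i \<in> {1..m+n} \<Longrightarrow> (\<Sum>\<alpha>\<in>support (m + n) A \<inter> hyperplane (m + n) i 1. w \<alpha>) = 1"
    "\<And>i. i \<in> {1..m+n} \<Longrightarrow>
      (\<Sum>\<alpha>\<in>support (m + n) A \<inter> hyperplane (m + n) i 0. w \<alpha>) = of_int total / of_int q - 1"
proof -
  obtain \<mu> \<nu> :: real where \<mu>\<nu>: "\<mu> \<ge> 0" "\<nu> \<ge> 0" "\<mu> * a + \<nu> * a' = m" "\<mu> * b + \<nu> * b' = n"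
    using cone_combination[OF assms] .
  have ta: "real a * x + real b * y = 1" and ta': "real a' * x + real b' * y = 1"
    using assms(1,2) q unfolding weight_eq tight_def by auto
  have "of_int total / of_int q = real m * x + real n * y"
    by (rule weight_eq[symmetric])
  also have "\<dots> = (\<mu> * a + \<nu> * a') * x + (\<mu> * b + \<nu> * b') * y"
    using \<mu>\<nu> by simp
  also have "\<dots> = \<mu> * (real a * x + real b * y) + \<nu> * (real a' * x + real b' * y)"
    by (simp add: algebra_simps)
  finally have W: "of_int total / of_int q = \<mu> + \<nu>"
    using ta ta' by simp
  have "a \<le> m" "b \<le> n" "a' \<le> m" "b' \<le> n"
    and "block_class m n a b \<subseteq> support (m + n) A" "block_class m n a' b' \<subseteq> support (m + n) A"
    using assms(1,2) block_class_subset_support by (auto simp: tight_def)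
  from balanced_weights[OF this \<mu>\<nu> m] show thesis
    using that unfolding W by metis
qed

text \<open>The bound on \<open>total\<close> keeps the sums over the hyperplanes with
  \<open>j = 0\<close> at most 1. Optimality is weak duality against \<open>L\<close>, which has the
  same weight.\<close>

lemma optimal_polyplex_exists:
  assumes "tight a b" "tight a' b'" "a * n \<le> b * m" "b' * m \<le> a' * n" and le: "total \<le> 2 * q"
  shows "\<exists>w. optimal_polyplex (m + n) A (of_int total / of_int q) w"
proof -
  obtain w :: "(nat \<Rightarrow> nat) \<Rightarrow> real"
    where w: "\<And>\<alpha>. w \<alpha> \<ge> 0" "(\<Sum>\<alpha>\<in>support (m + n) A. w \<alpha>) = of_int total / of_int q"
    "\<And>i. i \<in> {1..m+n} \<Longrightarrow> (\<Sum>\<alpha>\<in>support (m + n) A \<inter> hyperplane (m + n) i 1. w \<alpha>) = 1"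
    "\<And>i. i \<in> {1..m+n} \<Longrightarrow>
      (\<Sum>\<alpha>\<in>support (m + n) A \<inter> hyperplane (m + n) i 0. w \<alpha>) = of_int total / of_int q - 1"
    using balanced_weights_exist[OF assms(1-4)] by metis
  have "real_of_int total \<le> real_of_int (2 * q)"
    using le by (simp only: of_int_le_iff)
  then have "of_int total / of_int q \<le> (2 :: real)"
    using q by (simp add: field_simps del: of_int_add)
  then have "polyplex (m + n) A (of_int total / of_int q) w"
    unfolding polyplex_def using w by (auto simp del: of_int_add of_int_mult)
  moreover have "W' \<le> of_int total / of_int q" if "polyplex (m + n) A W' w'" for W' w'
    using weak_duality[OF that cover] unfolding cover_weight_eq .
  ultimately show ?thesis
    unfolding optimal_polyplex_def by blast
qed

lemma optimal_cover_of_optimal_polyplex: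
  assumes "optimal_polyplex (m + n) A (of_int total / of_int q) w"
  shows "optimal_hyperplane_cover (m + n) A L"
  unfolding optimal_hyperplane_cover_def cover_weight_eq
  using assms weak_duality cover by (auto simp: optimal_polyplex_def)

text \<open>If every tight pair has nonnegative scalar product with \<open>(u, v)\<close>, a small step in that direction
  keeps \<open>(x, y)\<close> a cover, since pairs that are not tight have slack at least \<open>1/q\<close>.\<close>

lemma not_optimal_if_descent_direction:
  fixes u v :: real
  assumes tight: "\<And>a b. tight a b \<Longrightarrow> real a * u + real b * v \<ge> 0"
    and descent: "real m * u + real n * v < 0"
  shows "\<not> optimal_hyperplane_cover (m + n) A L"
proof
  assume opt: "optimal_hyperplane_cover (m + n) A L"
  \<comment> \<open>\<open>M\<close> bounds the change \<open>a u + b v\<close> over the whole box.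
    With \<open>e M\<close> at most \<open>1/q\<close>, the step uses up no more than the slack of a
    pair that is not tight, and it keeps both weights nonnegative because \<open>x\<close> and
    \<open>y\<close> are at least \<open>1/q\<close>. The added 1 avoids division by zero.\<close>
  define M where "M = real m * \<bar>u\<bar> + real n * \<bar>v\<bar>"
  define e where "e = 1 / (of_int q * (M + 1))"
  have M: "M \<ge> \<bar>u\<bar>" "M \<ge> \<bar>v\<bar>" "M \<ge> 0"
    unfolding M_def using m n
    by (auto intro: add_increasing add_increasing2 simp: mult_le_cancel_right1)
  have e: "e > 0"
    unfolding e_def using q M by simp
  have eM: "e * M \<le> 1 / of_int q"
  proof -
    have "e * M = M / (M + 1) / of_int q"
      by (simp add: e_def)
    also have "\<dots> \<le> 1 / of_int q"
      using q M by (intro divide_right_mono) auto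
    finally show ?thesis .
  qed
  let ?x = "x + e * u" and ?y = "y + e * v"
  let ?L = "table_of (two_valued_tuple m ?x ?y)"
  have "x \<ge> 1 / of_int q" "y \<ge> 1 / of_int q"
    unfolding x y using p s q by (auto simp: divide_right_mono)
  moreover have "e * \<bar>u\<bar> \<le> e * M" "e * \<bar>v\<bar> \<le> e * M"
    using M e by auto
  moreover have "- (e * \<bar>u\<bar>) \<le> e * u" "- (e * \<bar>v\<bar>) \<le> e * v"
    using e by (simp_all add: abs_mult flip: mult_minus_right)
  ultimately have nonneg: "?x \<ge> 0" "?y \<ge> 0"
    using eM by linarith+
  have "hyperplane_cover (m + n) A ?L"
    unfolding hyperplane_cover_iff
  proof (intro conjI ballI)
    fix \<alpha> assume "\<alpha> \<in> support (m + n) A"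
    define a b where "a = ones {1..m} \<alpha>" and "b = ones {m+1..m+n} \<alpha>"
    have ge: "int a * p + int b * s \<ge> q" and le: "a \<le> m" "b \<le> n"
      using \<open>\<alpha> \<in> _\<close> ones_block_le by (auto simp: mem_support_iff a_def b_def)
    have "real a * ?x + real b * ?y \<ge> 1"
    proof (cases "int a * p + int b * s = q")
      case True
      then have "real a * u + real b * v \<ge> 0"
        using tight le by (auto simp: tight_def)
      then have "e * (real a * u + real b * v) \<ge> 0"
        using e by simp
      moreover have "real a * x + real b * y \<ge> 1"
        using weight_ge_iff ge by simp
      ultimately show ?thesis
        by (simp add: algebra_simps)
    next
      case False
      then have "real_of_int (int a * p + int b * s) \<ge> of_int (q + 1)"
        using ge by (subst of_int_le_iff) linarith
      then have "of_int (q + 1) / of_int q \<le> real_of_int (int a * p + int b * s) / of_int q"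
        using q by (intro divide_right_mono) auto
      then have "real a * x + real b * y \<ge> 1 + 1 / of_int q"
        unfolding weight_eq using q by (simp add: add_divide_distrib)
      moreover have "real a * - \<bar>u\<bar> \<le> real a * u" "real b * - \<bar>v\<bar> \<le> real b * v"
        by (intro mult_left_mono; simp)+
      moreover have "real a * \<bar>u\<bar> + real b * \<bar>v\<bar> \<le> M"
        unfolding M_def using le by (intro add_mono mult_right_mono) auto
      ultimately have "real a * u + real b * v \<ge> - M"
        by simp
      then have "e * (real a * u + real b * v) \<ge> e * - M"
        using e by (intro mult_left_mono) auto
      then show ?thesis
        using eM \<open>real a * x + real b * y \<ge> 1 + 1 / of_int q\<close> by (simp add: algebra_simps)
    qed
    then show "index_weight (m + n) ?L \<alpha> \<ge> 1"
      unfolding index_weight_two_valued a_def b_def .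
  qed (use nonneg in \<open>auto simp: table_of_def two_valued_tuple_def\<close>)
  then have "m * x + n * y \<le> m * ?x + n * ?y"
    using opt unfolding optimal_hyperplane_cover_def L cover_weight_two_valued[symmetric] by blast
  then have "e * (m * u + n * v) \<ge> 0"
    by (simp add: algebra_simps)
  then show False
    using e descent by (simp add: zero_le_mult_iff)
qed

text \<open>If all tight pairs were strictly on one side, the normal (n, -m) of the ray, or its
  negative, could be tilted slightly. By integrality \<open>a n - b m\<close> is at least 1 up to
  sign, so subtracting \<open>a/m\<close> or \<open>b/n\<close>, at most 1, keeps tight pairs
  nonnegative, while (m, n) gets the value -1.\<close>

lemma optimal_imp_tight_both_sides:
  assumes opt: "optimal_hyperplane_cover (m + n) A L"
  shows "\<exists>a b. tight a b \<and> a * n \<le> b * m" "\<exists>a b. tight a b \<and> b * m \<le> a * n"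
proof -
  show "\<exists>a b. tight a b \<and> a * n \<le> b * m"
  proof (rule ccontr)
    assume none: "\<not> ?thesis"
    have "real a * (real n - 1 / m) + real b * - real m \<ge> 0" if "tight a b" for a b
    proof -
      have "b * m + 1 \<le> a * n"
        using none that by (metis Suc_eq_plus1 Suc_leI linorder_not_le)
      then have "real b * m + 1 \<le> real a * n"
        by (metis of_nat_1 of_nat_add of_nat_le_iff of_nat_mult)
      moreover have "real a / m \<le> 1"
        using that m by (simp add: tight_def)
      ultimately show ?thesis
        by (simp add: algebra_simps)
    qed
    moreover have "real m * (real n - 1 / m) + real n * - real m < 0"
      using m by (simp add: algebra_simps)
    ultimately show False
      using not_optimal_if_descent_direction opt by blast
  qed
  show "\<exists>a b. tight a b \<and> b * m \<le> a * n"
  proof (rule ccontr)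
    assume none: "\<not> ?thesis"
    have "real a * - real n + real b * (real m - 1 / n) \<ge> 0" if "tight a b" for a b
    proof -
      have "a * n + 1 \<le> b * m"
        using none that by (metis Suc_eq_plus1 Suc_leI linorder_not_le)
      then have "real a * n + 1 \<le> real b * m"
        by (metis of_nat_1 of_nat_add of_nat_le_iff of_nat_mult)
      moreover have "real b / n \<le> 1"
        using that n by (simp add: tight_def)
      ultimately show ?thesis
        by (simp add: algebra_simps)
    qed
    moreover have "real m * - real n + real n * (real m - 1 / n) < 0"
      using n by (simp add: algebra_simps)
    ultimately show False
      using not_optimal_if_descent_direction opt by blast
  qed
qed

section \<open>Extremality and complementary pairs\<close>

text \<open>\<open>extremal_index_weight_le\<close> for a representative of the class; the left side
  of the conclusion is the value of the complementary pair \<open>(m - a, n - b)\<close>.\<close>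

lemma extremal_complement:
  assumes ext: "extremal (m + n) A" and ab: "a \<le> m" "b \<le> n"
    and less: "int a * p + int b * s < q"
  shows "total - (int a * p + int b * s) \<ge> q"
proof -
  obtain \<alpha> where \<alpha>: "\<alpha> \<in> block_class m n a b"
    using block_class_nonempty[OF ab] by blast
  then have w: "index_weight (m + n) L \<alpha> = of_int (int a * p + int b * s) / of_int q"
    unfolding index_weight_eq weight_eq[symmetric] by (simp add: block_class_def)
  have "\<alpha> \<in> indices (m + n)" "\<alpha> \<notin> support (m + n) A"
    using \<alpha> less by (auto simp: block_class_def mem_support_iff)
  moreover have "index_weight (m + n) L \<alpha> < 1"
    unfolding w using less q by (simp add: divide_less_eq del: of_int_add of_int_mult)
  ultimately have "index_weight (m + n) L \<alpha> \<le> cover_weight (m + n) L - 1"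
    using extremal_index_weight_le[OF ext cover] m by simp
  then have "of_int (int a * p + int b * s) \<le> (of_int total - of_int q :: real)"
    unfolding w cover_weight_eq using q by (simp add: field_simps del: of_int_add of_int_mult)
  then have "int a * p + int b * s \<le> total - q"
    by (simp only: of_int_diff[symmetric] of_int_le_iff)
  then show ?thesis
    by simp
qed

text \<open>The cover of weight 2 bounds \<open>total\<close> by \<open>2 q\<close>. At equality the
  balanced weights would sum to 1 on the hyperplanes with \<open>j = 0\<close> as well, giving a
  polydiagonal.\<close>

lemma extremal_total_less:
  assumes ext: "extremal (m + n) A" and opt: "optimal_hyperplane_cover (m + n) A L"
  shows "total < 2 * q"
proof -
  obtain L' where "hyperplane_cover (m + n) A L'" "cover_weight (m + n) L' = 2"
    using hyperplane_pair_cover[of "m + n" A] m by auto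
  then have "of_int total / of_int q \<le> (2 :: real)"
    using opt unfolding optimal_hyperplane_cover_def cover_weight_eq by metis
  then have "of_int total \<le> (of_int (2 * q) :: real)"
    using q by (simp add: divide_le_eq del: of_int_add)
  then have le: "total \<le> 2 * q"
    by (simp only: of_int_le_iff)
  have "total \<noteq> 2 * q"
  proof
    assume eq: "total = 2 * q"
    then have two: "of_int total / of_int q = (2 :: real)"
      using q by simp
    obtain a b a' b' where "tight a b" "tight a' b'" "a * n \<le> b * m" "b' * m \<le> a' * n"
      using optimal_imp_tight_both_sides[OF opt] by blast
    then obtain w :: "(nat \<Rightarrow> nat) \<Rightarrow> real" where w: "\<And>\<alpha>. w \<alpha> \<ge> 0"
      "\<And>i. i \<in> {1..m+n} \<Longrightarrow> (\<Sum>\<alpha>\<in>support (m + n) A \<inter> hyperplane (m + n) i 1. w \<alpha>) = 1"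
      "\<And>i. i \<in> {1..m+n} \<Longrightarrow>
        (\<Sum>\<alpha>\<in>support (m + n) A \<inter> hyperplane (m + n) i 0. w \<alpha>) = of_int total / of_int q - 1"
      using balanced_weights_exist by metis
    have "polydiagonal (m + n) A w"
      unfolding polydiagonal_def using w(1) w(2,3)[unfolded two] by simp
    then show False
      using ext by (auto simp: extremal_def)
  qed
  then show ?thesis
    using le by simp
qed

text \<open>If \<open>(a, b) = k (u, v)\<close> and \<open>(m, n) = g (u, v)\<close> with \<open>u, v\<close> coprime, then lowering either
  entry of the tight pair \<open>(a, b)\<close> shows \<open>x, y \<ge> 2 - g/k \<ge> 1/k\<close>, contradicting
  \<open>x u + y v = 1/k\<close>.\<close>

lemma extremal_no_tight_on_ray:
  assumes ext: "extremal (m + n) A" and less: "total < 2 * q" and t: "tight a b"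
  shows "a * n \<noteq> b * m"
proof
  assume ray: "a * n = b * m"
  have ab: "a \<le> m" "b \<le> n" "int a * p + int b * s = q"
    using t by (auto simp: tight_def)
  have "a \<noteq> 0 \<or> b \<noteq> 0"
    using ab q by (cases "a = 0"; cases "b = 0") auto
  then have pos: "a > 0" "b > 0"
    using ray m n by (cases "a = 0"; cases "b = 0"; auto)+
  have "int (a - 1) * p + int b * s = q - p" "int a * p + int (b - 1) * s = q - s"
    using ab(3) pos by (simp_all add: of_nat_diff algebra_simps)
  moreover have "a - 1 \<le> m" "b - 1 \<le> n"
    using ab by simp_all
  ultimately have ps: "p \<ge> 2 * q - total" "s \<ge> 2 * q - total"
    using extremal_complement[OF ext, of "a - 1" b] extremal_complement[OF ext, of a "b - 1"] ab(1,2) p s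
    by linarith+
  define k where "k = gcd a b"
  obtain u v where uv: "a = k * u" "b = k * v" "coprime u v"
    unfolding k_def using gcd_coprime_exists[of a b] pos by (auto simp: mult.commute)
  have k: "k > 0"
    using uv(1) pos by (cases "k = 0") auto
  have u: "u > 0" "v > 0"
    using uv pos by auto
  have uvn: "u * n = v * m"
    using ray k by (simp add: uv(1,2) mult.assoc)
  then have "u dvd m"
    using uv(3) by (metis coprime_dvd_mult_right_iff dvd_triv_left)
  then obtain g where g: "m = u * g"
    by blast
  then have gn: "n = v * g"
    using uvn u by (metis mult.left_commute mult_left_cancel less_irrefl)
  \<comment> \<open>\<open>z\<close> is the value of the primitive vector \<open>(u, v)\<close>, and
    \<open>q\<close> and \<open>total\<close> are its multiples by \<open>k\<close> and
    \<open>g\<close>. Integrality then bounds \<open>z\<close> by \<open>2 q - total\<close>, hence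
    by \<open>p\<close>, although \<open>z\<close> is at least \<open>p + s\<close>.\<close>
  define z where "z = int u * p + int v * s"
  have qz: "q = int k * z"
    using ab(3) by (simp add: uv z_def algebra_simps)
  have tz: "total = int g * z"
    by (simp add: g gn z_def algebra_simps)
  have z: "z > 0"
    using qz q k by (simp add: zero_less_mult_iff)
  have "int g * z < (2 * int k) * z"
    using less unfolding qz tz by (simp add: ac_simps)
  then have "int g + 1 \<le> 2 * int k"
    using z by simp
  then have "(int g + 1) * z \<le> (2 * int k) * z"
    using z by (intro mult_right_mono) auto
  then have "z \<le> 2 * q - total"
    unfolding tz using qz by (simp add: algebra_simps)
  moreover have "z \<ge> p + s"
    unfolding z_def using u p s by (intro add_mono) auto
  ultimately show False
    using ps p s by linarith
qed

text \<open>The cover weight is below 2, which excludes polydiagonals. Complementary values add up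
  to \<open>2 q - 1\<close>, so a value below \<open>q\<close> has a complement of value at least
  \<open>q\<close>.\<close>

lemma extremal_if_total:
  assumes total: "total = 2 * q - 1"
  shows "extremal (m + n) A"
  unfolding extremal_def
proof (intro conjI ballI)
  have d: "m + n \<ge> 1"
    using m by simp
  show "\<nexists>w. polydiagonal (m + n) A w"
  proof
    assume "\<exists>w. polydiagonal (m + n) A w"
    then obtain w where "polydiagonal (m + n) A w" ..
    then have "2 \<le> cover_weight (m + n) L"
      using weak_duality cover polydiagonal_imp_polyplex d by blast
    then show False
      unfolding cover_weight_eq total using q by (simp add: field_simps)
  qed
  fix \<alpha> assume "\<alpha> \<in> indices (m + n) - support (m + n) A"
  then have \<alpha>: "\<alpha> \<in> indices (m + n)"
    and less: "int (ones {1..m} \<alpha>) * p + int (ones {m+1..m+n} \<alpha>) * s < q"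
    by (auto simp: mem_support_iff)
  have "ones {1..m} (complement_index (m + n) \<alpha>) = m - ones {1..m} \<alpha>"
    "ones {m+1..m+n} (complement_index (m + n) \<alpha>) = n - ones {m+1..m+n} \<alpha>"
    using ones_complement_index[OF \<alpha>, of "{1..m}"] ones_complement_index[OF \<alpha>, of "{m+1..m+n}"]
    by auto
  then have "complement_index (m + n) \<alpha> \<in> support (m + n) A"
    unfolding mem_support_iff using complement_index_in_indices less total ones_block_le[of \<alpha>]
    by (auto simp: of_nat_diff algebra_simps)
  then show "\<exists>w. polydiagonal (m + n) (A(\<alpha> := 1)) w"
    by (rule polydiagonal_antipodal[OF \<alpha> _ d])
qed (rule zero_one_matrix_A)

section \<open>Arithmetic conditions from extremality and optimality\<close>

lemma tight_of_int:
  assumes "0 \<le> a" "a \<le> int m" "0 \<le> b" "b \<le> int n" "a * p + b * s = q"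
  shows "tight (nat a) (nat b)"
  using assms by (auto simp: tight_def nat_le_iff)

text \<open>A common divisor of \<open>p\<close> and \<open>s\<close> divides
  \<open>a p + b s = q\<close>, so it could be cancelled from both fractions.\<close>

lemma coprime_of_least_denominator:
  assumes least: "least_common_denominator x y q" and t: "tight a b"
  shows "gcd p s = 1"
proof -
  define g where "g = gcd p s"
  have g: "g > 0"
    unfolding g_def using p by (simp add: gcd_pos_int)
  have "g dvd int a * p + int b * s"
    unfolding g_def by (intro dvd_add dvd_mult) auto
  then have "g dvd q"
    using t by (simp add: tight_def)
  then obtain q' where q': "q = g * q'"
    by (rule dvdE)
  obtain p' s' where ps: "p = g * p'" "s = g * s'"
    unfolding g_def by (meson dvdE gcd_dvd1 gcd_dvd2)
  have q'_pos: "q' > 0"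
    using q g q' by (simp add: zero_less_mult_iff)
  moreover have "x = of_int p' / of_int q'" "y = of_int s' / of_int q'"
    unfolding x y q' ps using g by simp_all
  ultimately have "common_denominator x y q'"
    unfolding common_denominator_def by blast
  then have "g * q' \<le> 1 * q'"
    using least q' by (simp add: least_common_denominator_def)
  then have "g \<le> 1"
    using q'_pos mult_le_cancel_right_pos by blast
  then show ?thesis
    using g unfolding g_def by linarith
qed

text \<open>The lattice line of value \<open>q - 1\<close> meets the box close to the segment between the tight
  pairs, so the gap between \<open>q\<close> and the largest smaller value is 1.\<close>

lemma extremal_total_ge:
  assumes ext: "extremal (m + n) A" and gcd: "gcd p s = 1"
    and a: "0 \<le> a" "a + s \<le> int m" and b: "p \<le> b" "b \<le> int n" and eq: "a * p + b * s = q"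
  shows "total \<ge> 2 * q - 1"
proof -
  obtain c e where ce: "c * p + e * s = 1"
    using bezout_int[of p s] gcd by auto
  \<comment> \<open>Bezout coefficients are reduced modulo \<open>s\<close> so that the step
    \<open>(j, -f)\<close> lowers the value by exactly 1, with \<open>j\<close> in
    [0, s) and \<open>f\<close> in (0, p]. The room assumed around \<open>(a, b)\<close> keeps the
    new pair in the box.\<close>
  define j where "j = (- c) mod s"
  define f where "f = e - p * ((- c) div s)"
  have j: "0 \<le> j" "j < s"
    unfolding j_def using s by auto
  have j_eq: "j = - c - s * ((- c) div s)"
    unfolding j_def by (simp add: minus_mult_div_eq_mod)
  have "j * p + 1 = (- c - s * ((- c) div s)) * p + (c * p + e * s)"
    by (simp only: j_eq ce)
  also have "\<dots> = s * f"
    by (simp add: f_def algebra_simps)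
  finally have jf: "j * p + 1 = s * f" .
  have "s * f > 0"
    using jf j p by (metis add.commute add_pos_nonneg less_imp_le mult_nonneg_nonneg zero_less_one)
  then have f: "f > 0"
    using s by (simp add: zero_less_mult_iff)
  have "j * p \<le> (s - 1) * p"
    using j p by (intro mult_right_mono) auto
  then have "s * f \<le> s * p"
    using jf p by (simp add: algebra_simps)
  then have fp: "f \<le> p"
    using s by simp
  have v: "(a + j) * p + (b - f) * s = q - 1"
    using eq jf by (simp add: algebra_simps)
  have "nat (a + j) \<le> m" "nat (b - f) \<le> n"
    using a b j f by auto
  moreover have "int (nat (a + j)) * p + int (nat (b - f)) * s = q - 1"
    using v a b j fp by simp
  ultimately show ?thesis
    using extremal_complement[OF ext, of "nat (a + j)" "nat (b - f)"] by simp
qed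

lemma extremal_optimal_imp_conditions:
  assumes least: "least_common_denominator x y q"
    and ext: "extremal (m + n) A" and opt: "optimal_hyperplane_cover (m + n) A L"
  shows "gcd p s = 1 \<and> total = 2 * q - 1 \<and>
    (\<exists>rx ry lx ly :: int.
       0 \<le> rx \<and> rx < lx \<and> lx \<le> int m \<and> 0 \<le> ly \<and> ly < ry \<and> ry \<le> int n \<and>
       (\<exists>i :: int. i > 0 \<and> lx = rx + i * s \<and> ly = ry - i * p) \<and>
       (rx < s \<or> ry + p > int n) \<and> (lx + s > int m \<or> ly < p) \<and>
       rx * p + ry * s = q \<and> lx * p + ly * s = q)"
proof -
  have less: "total < 2 * q"
    by (rule extremal_total_less[OF ext opt])
  obtain a b a' b' where t: "tight a b" "tight a' b'" "a * n \<le> b * m" "b' * m \<le> a' * n"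
    using optimal_imp_tight_both_sides[OF opt] by blast
  have strict: "a * n < b * m" "b' * m < a' * n"
    using t extremal_no_tight_on_ray[OF ext less] by (metis le_neq_implies_less)+
  have gcd: "gcd p s = 1"
    by (rule coprime_of_least_denominator[OF least t(1)])
  \<comment> \<open>Otherwise \<open>(a', b')\<close> would be dominated by \<open>(a, b)\<close>,
    strictly in the second entry, and could not have the same value.\<close>
  have "a < a'"
  proof (rule ccontr)
    assume "\<not> a < a'"
    then have le: "a' \<le> a" by simp
    then have "a' * n \<le> a * n" by simp
    then have "b' * m < b * m"
      using strict by linarith
    then have "b' < b" by simp
    then have "int a' * p + int b' * s < int a * p + int b * s"
      using le p s by (intro add_le_less_mono mult_right_mono mult_strict_right_mono) auto
    then show False
      using t by (simp add: tight_def)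
  qed
  \<comment> \<open>The required points are the tight pairs with least and greatest first
    entry.\<close>
  define X where "X = {a. \<exists>b. tight a b}"
  have fin: "finite X"
    by (rule finite_subset[of _ "{..m}"]) (auto simp: X_def tight_def)
  have X: "a \<in> X" "a' \<in> X"
    using t by (auto simp: X_def)
  then have "Min X \<in> X" "Max X \<in> X" "Min X \<le> a" "a' \<le> Max X"
    using fin by (auto intro: Min_in Max_in)
  then obtain ry ly where tr: "tight (Min X) ry" and tl: "tight (Max X) ly"
    and lt: "Min X < Max X"
    using \<open>a < a'\<close> unfolding X_def by fastforce
  define rx lx where "rx = Min X" and "lx = Max X"
  have r: "rx \<le> m" "ry \<le> n" "int rx * p + int ry * s = q"
    and l: "lx \<le> m" "ly \<le> n" "int lx * p + int ly * s = q"
    using tr tl by (auto simp: rx_def lx_def tight_def)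
  have bound: "rx \<le> c \<and> c \<le> lx" if "tight c e" for c e
    unfolding rx_def lx_def using that fin by (auto simp: X_def intro: Min_le Max_ge)
  have diff: "(int lx - int rx) * p = (int ry - int ly) * s"
    using r(3) l(3) by (simp add: algebra_simps)
  then have "s dvd (int lx - int rx) * p"
    by simp
  then have "s dvd int lx - int rx"
    using gcd by (metis coprime_dvd_mult_left_iff coprime_iff_gcd_eq_1 gcd.commute)
  then obtain i where i: "int lx - int rx = s * i" ..
  have "i > 0"
    using i lt s unfolding rx_def[symmetric] lx_def[symmetric]
    by (smt (verit) mult_nonneg_nonpos of_nat_less_iff)
  have "(int ry - int ly) * s = (i * p) * s"
    using diff i by (simp add: algebra_simps)
  then have i': "int ry - int ly = i * p"
    using s by simp
  have ip: "i * p \<ge> p" "i * s \<ge> s"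
    using \<open>i > 0\<close> p s by simp_all
  \<comment> \<open>If both inequalities failed, the shift by \<open>(-s, p)\<close> would give a
    tight pair with a smaller first entry. The other end is treated with the opposite shift.\<close>
  have r_extreme: "int rx < s \<or> int ry + p > int n"
  proof (rule ccontr)
    assume not_extreme: "\<not> ?thesis"
    then have "tight (nat (int rx - s)) (nat (int ry + p))"
      using r p s by (intro tight_of_int) (auto simp: algebra_simps)
    then have "int rx \<le> int rx - s"
      using bound not_extreme by fastforce
    then show False
      using s by simp
  qed
  have l_extreme: "int lx + s > int m \<or> int ly < p"
  proof (rule ccontr)
    assume not_extreme: "\<not> ?thesis"
    then have "tight (nat (int lx + s)) (nat (int ly - p))"
      using l p s by (intro tight_of_int) (auto simp: algebra_simps)
    then have "int lx + s \<le> int lx"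
      using bound not_extreme by fastforce
    then show False
      using s by simp
  qed
  \<comment> \<open>Since \<open>i\<close> is at least 1, \<open>rx + s\<close> is at most
    \<open>lx\<close> and \<open>p\<close> is at most \<open>ry\<close>, which is the room that the
    lattice step needs.\<close>
  have "total \<ge> 2 * q - 1"
    using r l i i' ip by (intro extremal_total_ge[OF ext gcd, of "int rx" "int ry"]) (auto simp: algebra_simps)
  then have total: "total = 2 * q - 1"
    using less by simp
  have "int rx < int lx" "int ly < int ry" "int lx = int rx + i * s" "int ly = int ry - i * p"
    using i i' ip p s by (auto simp: algebra_simps)
  then have "0 \<le> int rx \<and> int rx < int lx \<and> int lx \<le> int m \<and>
    0 \<le> int ly \<and> int ly < int ry \<and> int ry \<le> int n \<and>
    (\<exists>i :: int. i > 0 \<and> int lx = int rx + i * s \<and> int ly = int ry - i * p) \<and>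
    (int rx < s \<or> int ry + p > int n) \<and> (int lx + s > int m \<or> int ly < p) \<and>
    int rx * p + int ry * s = q \<and> int lx * p + int ly * s = q"
    using r l r_extreme l_extreme \<open>i > 0\<close> by (intro conjI exI[of _ i]) simp_all
  then show ?thesis
    using gcd total by blast
qed

end

section \<open>The converse: the given points lie on opposite sides of the ray\<close>

text \<open>The second tight point gives the room \<open>a + s \<le> m\<close> and
  \<open>p \<le> b\<close>. With the extremeness condition this places \<open>a\<close> in the lower
  half of its range or \<open>b\<close> in the upper half, which contradicts being strictly on the
  wrong side. All quantities are free integers so that the two blocks can be exchanged.\<close>

lemma extreme_point_side:
  fixes m n p s q a b i :: int
  assumes pos: "m > 0" "n > 0" "p > 0" "s > 0" "q > 0" and total: "m * p + n * s = 2 * q - 1"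
    and ab: "0 \<le> a" "0 \<le> b" "a * p + b * s = q"
    and i: "i > 0" "a + i * s \<le> m" "0 \<le> b - i * p"
    and extreme: "a < s \<or> b + p > n"
  shows "a * n \<le> b * m"
proof (rule ccontr)
  assume "\<not> a * n \<le> b * m"
  then have gt: "b * m + 1 \<le> a * n" by simp
  have ip: "i * p \<ge> p" "i * s \<ge> s"
    using i pos by simp_all
  from extreme show False
  proof
    assume "a < s"
    then have m: "2 * a + 1 \<le> m"
      using i ip by linarith
    \<comment> \<open>Multiplying the wrong-side inequality by \<open>s\<close> eliminates
      \<open>n\<close>; with \<open>2 a + 1 \<le> m\<close> it would make \<open>q + s + a\<close>
      nonpositive.\<close>
    have "(2 * q - 1) * a = m * p * a + (a * n) * s"
      unfolding total[symmetric] by (simp add: algebra_simps)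
    also have "\<dots> \<ge> m * p * a + (b * m + 1) * s"
      using gt pos by (intro add_left_mono mult_right_mono) auto
    also have "m * p * a + (b * m + 1) * s = m * (a * p + b * s) + s"
      by (simp add: algebra_simps)
    finally have "m * q + s \<le> (2 * q - 1) * a"
      by (simp add: ab)
    moreover have "(2 * a + 1) * q \<le> m * q"
      using m pos by (intro mult_right_mono) auto
    ultimately show False
      using pos ab by (simp add: algebra_simps)
  next
    assume "b + p > n"
    then have n: "n + 1 \<le> 2 * b"
      using i ip by linarith
    \<comment> \<open>Multiplying by \<open>p\<close> eliminates \<open>m\<close> instead. The
      outcome \<open>2 q - 1 \<le> n\<close> is impossible because
      \<open>n \<le> n s < m p + n s\<close>.\<close>
    have "n * q = (a * n) * p + b * n * s"
      unfolding ab(3)[symmetric] by (simp add: algebra_simps)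
    also have "\<dots> \<ge> (b * m + 1) * p + b * n * s"
      using gt pos by (intro add_right_mono mult_right_mono) auto
    also have "(b * m + 1) * p + b * n * s = b * (m * p + n * s) + p"
      by (simp add: algebra_simps)
    finally have "b * (2 * q - 1) + p \<le> n * q"
      by (simp add: total)
    moreover have "(n + 1) * (2 * q - 1) \<le> (2 * b) * (2 * q - 1)"
      using n pos by (intro mult_right_mono) auto
    ultimately have "2 * q - 1 \<le> n"
      using pos by (simp add: algebra_simps)
    moreover have "n * 1 \<le> n * s"
      using pos by (intro mult_left_mono) auto
    moreover have "m * p > 0"
      using pos by simp
    ultimately show False
      using total by linarith
  qed
qed

context two_weights
begin

lemma conditions_imp_optimal_polyplex:
  assumes total: "total = 2 * q - 1"
    and r: "0 \<le> rx" "ry \<le> int n" "rx * p + ry * s = q"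
    and l: "lx \<le> int m" "0 \<le> ly" "lx * p + ly * s = q"
    and i: "i > 0" "lx = rx + i * s" "ly = ry - i * p"
    and extreme: "rx < s \<or> ry + p > int n" "lx + s > int m \<or> ly < p"
  shows "\<exists>w. optimal_polyplex (m + n) A (of_int total / of_int q) w"
proof -
  have ip: "i * p > 0" "i * s > 0"
    using i p s by simp_all
  have bounds: "rx \<le> int m" "0 \<le> ry" "0 \<le> lx" "ly \<le> int n"
    using r l i ip by linarith+
  have mn: "int m > 0" "int n > 0"
    using m n by simp_all
  have "rx + i * s \<le> int m" "0 \<le> ry - i * p"
    using l i by simp_all
  note extreme_point_side[OF mn p s q total r(1) bounds(2) r(3) i(1) this extreme(1)]
  \<comment> \<open>The hypotheses are rewritten with the blocks exchanged, so that the same lemma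
    places \<open>(lx, ly)\<close> on the other side.\<close>
  moreover have "int n * s + int m * p = 2 * q - 1" "ly * s + lx * p = q" "ly + i * p \<le> int n"
    "0 \<le> lx - i * s" "ly < p \<or> lx + s > int m"
    using total l r i extreme by linarith+
  moreover note extreme_point_side[OF mn(2,1) s p q _ l(2) bounds(3) _ i(1)]
  ultimately have "int (nat rx * n) \<le> int (nat ry * m)" "int (nat ly * m) \<le> int (nat lx * n)"
    using r l bounds by simp_all
  then have "nat rx * n \<le> nat ry * m" "nat ly * m \<le> nat lx * n"
    by (simp_all only: of_nat_le_iff)
  moreover have "tight (nat rx) (nat ry)" "tight (nat lx) (nat ly)"
    using r l bounds by (simp_all only: tight_of_int)
  ultimately show ?thesis
    using optimal_polyplex_exists total by simp
qed

end

theorem theorem18: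
  fixes tx ty d :: nat and x y :: real and p s q :: int
    and \<Lambda> :: "nat \<Rightarrow> real" and A :: "(nat \<Rightarrow> nat) \<Rightarrow> nat"
  assumes "tx \<ge> 1" and "ty \<ge> 1" and "d = tx + ty"
    and "1 > x" and "x > y" and "y > 0"
    and "p > 0" and "s > 0" and "q > 0"
    and "x = of_int p / of_int q" and "y = of_int s / of_int q"
    and "least_common_denominator x y q"
    and "\<Lambda> = two_valued_tuple tx x y"
    and "A = matrix_of d \<Lambda>"
  shows "(extremal d A \<and> optimal_hyperplane_cover d A (table_of \<Lambda>) \<longleftrightarrow>
            gcd p s = 1 \<and>
            int tx * p + int ty * s = 2 * q - 1 \<and>
            (\<exists>rx ry lx ly :: int.
               0 \<le> rx \<and> rx < lx \<and> lx \<le> int tx \<and>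
               0 \<le> ly \<and> ly < ry \<and> ry \<le> int ty \<and>
               (\<exists>i :: int. i > 0 \<and> lx = rx + i * s \<and> ly = ry - i * p) \<and>
               (rx < s \<or> ry + p > int ty) \<and> (lx + s > int tx \<or> ly < p) \<and>
               rx * p + ry * s = q \<and> lx * p + ly * s = q)) \<and>
         (extremal d A \<and> optimal_hyperplane_cover d A (table_of \<Lambda>) \<longrightarrow>
            has_deficiency d A (1 / of_int q))"
proof -
  interpret two_weights tx ty p s q x y A "table_of \<Lambda>"
    by unfold_locales (use assms in auto)
  let ?lhs = "extremal d A \<and> optimal_hyperplane_cover d A (table_of \<Lambda>)"
  let ?points = "\<exists>rx ry lx ly :: int.
               0 \<le> rx \<and> rx < lx \<and> lx \<le> int tx \<and>
               0 \<le> ly \<and> ly < ry \<and> ry \<le> int ty \<and>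
               (\<exists>i :: int. i > 0 \<and> lx = rx + i * s \<and> ly = ry - i * p) \<and>
               (rx < s \<or> ry + p > int ty) \<and> (lx + s > int tx \<or> ly < p) \<and>
               rx * p + ry * s = q \<and> lx * p + ly * s = q"
  have "gcd p s = 1 \<and> total = 2 * q - 1 \<and> ?points" if ?lhs
    using extremal_optimal_imp_conditions that assms(12) unfolding assms(3) by blast
  moreover have "?lhs \<and> has_deficiency d A (1 / of_int q)" if total: "total = 2 * q - 1" and points: ?points
  proof -
    have ext: "extremal d A"
      using extremal_if_total total by (simp add: assms(3))
    \<comment> \<open>This one polyplex certifies both that the cover is optimal and that the
      deficiency is \<open>2 - total / q\<close>.\<close>
    obtain w where w: "optimal_polyplex d A (of_int total / of_int q) w"
      using points conditions_imp_optimal_polyplex[OF total] unfolding assms(3) by metis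
    have "1 / of_int q = 2 - (of_int total / of_int q :: real)"
      unfolding total using q by (simp add: field_simps)
    then show ?thesis
      using ext w optimal_cover_of_optimal_polyplex unfolding has_deficiency_def assms(3) by blast
  qed
  ultimately show ?thesis
    by blast
qed

end
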